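(* Let $\mathbf{X}$ be a Banach space and let $\mathrm{F}\in\mathcal{F}_{\mathbf{X}}$. Let $\mathrm{Z}$ be a linear operator in $\mathbf{X}$ with domain $\mathcal{D}(\mathrm{Z})\subset\mathcal{D}(\mathrm{F}'(0))$ such that $\mathrm{Z}f=\mathrm{F}'(0)f$ for every $f\in\mathcal{D}(\mathrm{Z})$. Then $\mathrm{Z}$ is closable.
   Context: $\mathcal{L}(\mathbf{X})$ is the space of bounded linear operators on the Banach space $\mathbf{X}$ (over $\mathbb{R}$ or $\mathbb{C}$). For $\mathrm{S}:[0,\infty)\to\mathcal{L}(\mathbf{X})$, the (strong) derivative at $0$ is the linear operator $\mathrm{S}'(0)\psi=\lim_{h\to 0}h^{-1}(\mathrm{S}(h)\psi-\mathrm{S}(0)\psi)$ (norm limit, $h>0$), whose domain $\mathcal{D}(\mathrm{S}'(0))$ is the set of all $\psi\in\mathbf{X}$ for which the limit exists. $\mathcal{F}_{\mathbf{X}}$ is the set of all functions $\mathrm{F}:[0,\infty)\to\mathcal{L}(\mathbf{X})$ such that (i) $\mathrm{F}(0)=\mathrm{I}$ and there exist $M\ge 1$, $a\in\mathbb{R}$ with $\|\mathrm{F}(s/n)^m\|\le M\exp(\frac{am}{n}s)$ for all $n,m\in\mathbb{N}$, $s\ge 0$; (ii) $\mathcal{D}(\mathrm{F}'(0))$ is dense in $\mathbf{X}$. *)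

theory Defs
  imports "HOL-Analysis.Analysis"
begin

text \<open>
  Banach spaces over the real or the complex numbers are treated uniformly: the scalars form a
  type \<open>'k\<close> of class \<open>real_normed_field\<close> (instances include \<open>real\<close> and \<open>complex\<close>; by the
  Gelfand--Mazur theorem there are no others up to isomorphism), and \<open>smul\<close> is a scalar
  multiplication on a real Banach space, compatible with the real one and with the norm.
\<close>

locale banach_space_over = vector_space smul
  for smul :: "'k::real_normed_field \<Rightarrow> 'x::banach \<Rightarrow> 'x" +
  assumes scale_of_real: "smul (of_real r) x = r *\<^sub>R x"
    and norm_scale: "norm (smul c x) = norm c * norm x"

lemma banach_space_over_real:
  "banach_space_over (scaleR :: real \<Rightarrow> 'x::banach \<Rightarrow> 'x)"
  by unfold_locales (auto simp: algebra_simps)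

lemma banach_space_over_complex:
  "banach_space_over ((*) :: complex \<Rightarrow> complex \<Rightarrow> complex)"
  by unfold_locales (auto simp: algebra_simps norm_mult scaleR_conv_of_real)

definition bounded_operators ::
    "('k::real_normed_field \<Rightarrow> 'x::banach \<Rightarrow> 'x) \<Rightarrow> ('x \<Rightarrow> 'x) set" where
  "bounded_operators smul = {T. Vector_Spaces.linear smul smul T \<and> bounded_linear T}"

text \<open>
  A function on \<open>[0,\<infinity>)\<close> is represented by a function on \<open>real\<close> of which only the values at
  nonnegative arguments matter.
\<close>

definition deriv0_domain :: "(real \<Rightarrow> 'x::real_normed_vector \<Rightarrow> 'x) \<Rightarrow> 'x set" where
  "deriv0_domain S =
     {\<psi>. \<exists>\<phi>. ((\<lambda>h. (1 / h) *\<^sub>R (S h \<psi> - S 0 \<psi>)) \<longlongrightarrow> \<phi>) (at_right 0)}"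

definition deriv0 :: "(real \<Rightarrow> 'x::real_normed_vector \<Rightarrow> 'x) \<Rightarrow> 'x \<Rightarrow> 'x" where
  "deriv0 S \<psi> = Lim (at_right 0) (\<lambda>h. (1 / h) *\<^sub>R (S h \<psi> - S 0 \<psi>))"

text \<open>The class of functions written \<open>\<F>\<close> with index \<open>X\<close>; the indices \<open>n\<close>, \<open>m\<close> are positive.\<close>

definition class_F ::
    "('k::real_normed_field \<Rightarrow> 'x::banach \<Rightarrow> 'x) \<Rightarrow> (real \<Rightarrow> 'x \<Rightarrow> 'x) set" where
  "class_F smul = {F.
     (\<forall>t\<ge>0. F t \<in> bounded_operators smul) \<and>
     F 0 = id \<and>
     (\<exists>M a :: real. M \<ge> 1 \<and>
        (\<forall>(n::nat)\<ge>1. \<forall>(m::nat)\<ge>1. \<forall>s\<ge>0.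
           onorm (F (s / real n) ^^ m) \<le> M * exp (a * real m / real n * s))) \<and>
     closure (deriv0_domain F) = UNIV}"

text \<open>
  A linear operator in \<open>X\<close> is a pair of a subspace \<open>D\<close> and a map \<open>Z\<close> that is linear on \<open>D\<close>; values
  of \<open>Z\<close> outside \<open>D\<close> are irrelevant.
\<close>

definition linear_operator ::
    "('k::real_normed_field \<Rightarrow> 'x::banach \<Rightarrow> 'x) \<Rightarrow> 'x set \<Rightarrow> ('x \<Rightarrow> 'x) \<Rightarrow> bool" where
  "linear_operator smul D Z \<longleftrightarrow>
     module.subspace smul D \<and>
     (\<forall>x\<in>D. \<forall>y\<in>D. Z (x + y) = Z x + Z y) \<and>
     (\<forall>c. \<forall>x\<in>D. Z (smul c x) = smul c (Z x))"

definition closed_operator ::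
    "('k::real_normed_field \<Rightarrow> 'x::banach \<Rightarrow> 'x) \<Rightarrow> 'x set \<Rightarrow> ('x \<Rightarrow> 'x) \<Rightarrow> bool" where
  "closed_operator smul D Z \<longleftrightarrow>
     linear_operator smul D Z \<and> closed ((\<lambda>x. (x, Z x)) ` D)"

text \<open>Closability is the existence of a closed linear extension.\<close>

definition closable ::
    "('k::real_normed_field \<Rightarrow> 'x::banach \<Rightarrow> 'x) \<Rightarrow> 'x set \<Rightarrow> ('x \<Rightarrow> 'x) \<Rightarrow> bool" where
  "closable smul D Z \<longleftrightarrow>
     (\<exists>D' Z'. closed_operator smul D' Z' \<and> D \<subseteq> D' \<and> (\<forall>x\<in>D. Z' x = Z x))"

end

theory Submission
  imports Defs
begin

text \<open>
  Let \<open>A\<close> be the derivative of \<open>F\<close> at \<open>0\<close>. The power bound makes \<open>F h\<close> have norm at most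
  \<open>exp (a h)\<close> in an equivalent norm depending on \<open>h\<close>, but with equivalence constant \<open>M\<close>
  independent of \<open>h\<close>. Hence the difference quotients, and in the limit \<open>A\<close>, are quasi-dissipative
  up to the factor \<open>M\<close>: \<open>(1 - \<lambda> a) \<parallel>x\<parallel> \<le> M \<parallel>x - \<lambda> A x\<parallel>\<close> for \<open>\<lambda> \<ge> 0\<close>. If \<open>f\<^sub>k \<rightarrow> 0\<close> and \<open>A f\<^sub>k \<rightarrow> g\<close>,
  apply this to \<open>x = f\<^sub>k + \<lambda> v\<close>, let \<open>k \<rightarrow> \<infinity>\<close>, divide by \<open>\<lambda>\<close> and let \<open>\<lambda> \<rightarrow> 0\<close> to get
  \<open>\<parallel>v\<parallel> \<le> M \<parallel>v - g\<parallel>\<close> for all \<open>v\<close> in the dense domain of \<open>A\<close>; letting \<open>v \<rightarrow> g\<close> yields \<open>g = 0\<close>.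
\<close>

text \<open>The supremum \<open>S\<close> is an equivalent norm of \<open>x\<close> in which
  \<open>T\<close> has bound \<open>c\<close>, so the triangle inequality for
  \<open>(1 + s) x = y + s T x\<close> suffices, where \<open>y\<close> is the vector on the
  right-hand side. The factor \<open>M\<close> enters only once, in the return to
  \<open>norm y\<close>.\<close>

lemma power_bounded_dissipative:
  fixes T :: "'x::real_normed_vector \<Rightarrow> 'x"
  assumes lin: "linear T"
    and c: "c > 0" and s: "s \<ge> 0"
    and bound: "\<And>m x. norm ((T ^^ m) x) \<le> M * c ^ m * norm x"
  shows "(1 + s - s * c) * norm x \<le> M * norm ((1 + s) *\<^sub>R x - s *\<^sub>R T x)"
proof -
  define y where "y = (1 + s) *\<^sub>R x - s *\<^sub>R T x"
  define p where "p m z = norm ((T ^^ m) z) / c ^ m" for m z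
  \<comment> \<open>the norm of \<open>x\<close> in which \<open>T\<close> is bounded by \<open>c\<close>\<close>
  define S where "S = (SUP m. p m x)"
  have p_le: "p m z \<le> M * norm z" for m z
    using bound[of m z] c by (simp add: p_def divide_le_eq mult_ac)
  have bdd: "bdd_above (range (\<lambda>m. p m x))"
    using p_le by (auto intro!: bdd_aboveI2)
  have p_S: "p m x \<le> S" for m
    unfolding S_def by (rule cSUP_upper[OF _ bdd]) simp
  have lin_pow: "linear (T ^^ m)" for m
  proof (induction m)
    case 0
    show ?case unfolding funpow.simps by (rule linear_id)
  next
    case (Suc m)
    then show ?case unfolding funpow.simps by (rule linear_compose[OF _ lin])
  qed
  have step: "(1 + s) * p m x \<le> M * norm y + s * c * S" for m
  proof -
    \<comment> \<open>Powers of \<open>T\<close> commute with \<open>T\<close>, so applying one to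
      the definition of \<open>y\<close> shifts the index by one; division by \<open>c ^ m\<close>
      then leaves a factor \<open>c\<close> on the shifted term.\<close>
    have "(1 + s) *\<^sub>R (T ^^ m) x = (T ^^ m) y + s *\<^sub>R (T ^^ Suc m) x"
      unfolding y_def
      by (simp add: linear_diff[OF lin_pow] linear_scale[OF lin_pow] funpow_swap1)
    then have "norm ((1 + s) *\<^sub>R (T ^^ m) x) \<le> norm ((T ^^ m) y) + norm (s *\<^sub>R (T ^^ Suc m) x)"
      by (metis norm_triangle_ineq)
    then have "(1 + s) * norm ((T ^^ m) x) \<le> norm ((T ^^ m) y) + s * norm ((T ^^ Suc m) x)"
      using s by simp
    then have "(1 + s) * norm ((T ^^ m) x) / c ^ m
        \<le> (norm ((T ^^ m) y) + s * norm ((T ^^ Suc m) x)) / c ^ m"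
      using c by (intro divide_right_mono) auto
    also have "\<dots> = p m y + s * c * p (Suc m) x"
      using c by (simp add: p_def field_simps)
    also have "\<dots> \<le> M * norm y + s * c * S"
      using p_le[of m y] p_S[of "Suc m"] s c by (intro add_mono mult_left_mono) auto
    finally show ?thesis by (simp add: p_def)
  qed
  \<comment> \<open>Since \<open>S\<close> is finite, its occurrence on the right of
    \<open>step\<close> can be absorbed on the left.\<close>
  have "S \<le> (M * norm y + s * c * S) / (1 + s)"
    unfolding S_def
    by (rule cSUP_least) (use step s in \<open>auto simp: S_def[symmetric] le_divide_eq mult_ac\<close>)
  then have S_le: "(1 + s - s * c) * S \<le> M * norm y"
    using s by (simp add: le_divide_eq algebra_simps)
  \<comment> \<open>The bound of \<open>norm x\<close> by \<open>S\<close>, from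
    \<open>m = 0\<close>, may only be multiplied by a nonnegative factor. For a negative factor the
    two sides have opposite signs, the right one because \<open>norm y\<close> is at most
    \<open>M * norm y\<close>.\<close>
  show ?thesis
  proof (cases "1 + s - s * c \<ge> 0")
    case True
    have "norm x \<le> S"
      using p_S[of 0] by (simp add: p_def)
    then have "(1 + s - s * c) * norm x \<le> (1 + s - s * c) * S"
      using True by (rule mult_left_mono)
    then show ?thesis using S_le by (simp add: y_def)
  next
    case False
    then have "(1 + s - s * c) * norm x \<le> 0"
      by (simp add: mult_nonpos_nonneg)
    also have "0 \<le> M * norm y"
      using p_le[of 0 y] by (simp add: p_def order_trans[OF norm_ge_zero])
    finally show ?thesis by (simp add: y_def)
  qed
qed

text \<open>Stated for a relation, so that limits of graph points can be handled before
  single-valuedness is known; the conclusion is exactly what makes the closure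
  single-valued.\<close>

lemma quasi_dissipative_closable:
  fixes A :: "('x::real_normed_vector \<times> 'x) set"
  assumes add: "\<And>x x' y y'. (x, x') \<in> A \<Longrightarrow> (y, y') \<in> A \<Longrightarrow> (x + y, x' + y') \<in> A"
    and scale: "\<And>r x x'. (x, x') \<in> A \<Longrightarrow> (r *\<^sub>R x, r *\<^sub>R x') \<in> A"
    and diss: "\<And>l x x'. l \<ge> 0 \<Longrightarrow> (x, x') \<in> A \<Longrightarrow> (1 - l * a) * norm x \<le> M * norm (x - l *\<^sub>R x')"
    and dense: "closure (Domain A) = UNIV"
    and g: "(0, g) \<in> closure A"
  shows "g = 0"
proof -
  obtain u where u: "\<And>k. u k \<in> A" and ulim: "u \<longlonglongrightarrow> (0, g)"
    using g by (auto simp: closure_sequential)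
  have f: "(\<lambda>k. fst (u k)) \<longlonglongrightarrow> 0" and f': "(\<lambda>k. snd (u k)) \<longlonglongrightarrow> g"
    using tendsto_fst[OF ulim] tendsto_snd[OF ulim] by simp_all
  have bound: "norm v \<le> M * norm (v - g)" if "(v, v') \<in> A" for v v'
  proof -
    have *: "(1 - l * a) * norm v \<le> M * norm (v - (g + l *\<^sub>R v'))" if l: "l > 0" for l
    proof -
      \<comment> \<open>The test pair is \<open>u k + l (v, v')\<close> with the same
        \<open>l\<close> as the parameter of \<open>diss\<close>: once \<open>k\<close> tends to
        infinity, both sides carry a factor \<open>l\<close>.\<close>
      have "(1 - l * a) * norm (fst (u k) + l *\<^sub>R v)
          \<le> M * norm (fst (u k) + l *\<^sub>R v - l *\<^sub>R (snd (u k) + l *\<^sub>R v'))" for k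
        by (rule diss) (use l u[of k] \<open>(v, v') \<in> A\<close> in \<open>auto intro!: add scale\<close>)
      moreover have "(\<lambda>k. (1 - l * a) * norm (fst (u k) + l *\<^sub>R v))
          \<longlonglongrightarrow> (1 - l * a) * norm (0 + l *\<^sub>R v)"
        by (intro tendsto_intros f)
      moreover have "(\<lambda>k. M * norm (fst (u k) + l *\<^sub>R v - l *\<^sub>R (snd (u k) + l *\<^sub>R v')))
          \<longlonglongrightarrow> M * norm (0 + l *\<^sub>R v - l *\<^sub>R (g + l *\<^sub>R v'))"
        by (intro tendsto_intros f f')
      ultimately have "(1 - l * a) * norm (0 + l *\<^sub>R v)
          \<le> M * norm (0 + l *\<^sub>R v - l *\<^sub>R (g + l *\<^sub>R v'))"
        by (intro LIMSEQ_le) auto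
      also have "0 + l *\<^sub>R v - l *\<^sub>R (g + l *\<^sub>R v') = l *\<^sub>R (v - (g + l *\<^sub>R v'))"
        by (simp add: scaleR_diff_right)
      finally have "l * ((1 - l * a) * norm v) \<le> l * (M * norm (v - (g + l *\<^sub>R v')))"
        using l by (simp add: mult_ac)
      then show ?thesis using l by simp
    qed
    have "((\<lambda>l. (1 - l * a) * norm v) \<longlongrightarrow> (1 - 0 * a) * norm v) (at_right 0)"
      by (intro tendsto_intros)
    moreover have "((\<lambda>l. M * norm (v - (g + l *\<^sub>R v'))) \<longlongrightarrow> M * norm (v - (g + 0 *\<^sub>R v')))
        (at_right 0)"
      by (intro tendsto_intros)
    ultimately have "(1 - 0 * a) * norm v \<le> M * norm (v - (g + 0 *\<^sub>R v'))"
      using * by (intro tendsto_le[OF trivial_limit_at_right_real])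
        (auto simp: eventually_at_filter)
    then show ?thesis by simp
  qed
  \<comment> \<open>As \<open>v'\<close> has dropped out of \<open>bound\<close>, norm approximation
    of \<open>g\<close> by domain elements suffices, without control of their images.\<close>
  have "g \<in> closure (Domain A)" using dense by simp
  then obtain w where w: "\<And>k. w k \<in> Domain A" and wlim: "w \<longlonglongrightarrow> g"
    by (auto simp: closure_sequential)
  have "norm (w k) \<le> M * norm (w k - g)" for k
    using w[of k] bound by auto
  moreover have "(\<lambda>k. norm (w k)) \<longlonglongrightarrow> norm g"
    by (intro tendsto_intros wlim)
  moreover have "(\<lambda>k. M * norm (w k - g)) \<longlonglongrightarrow> M * norm (g - g)"
    by (intro tendsto_intros wlim)
  ultimately have "norm g \<le> M * norm (g - g)"
    using LIMSEQ_le by blast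
  then show ?thesis by simp
qed

lemma (in banach_space_over) tendsto_smul:
  assumes "(f \<longlongrightarrow> x) G"
  shows "((\<lambda>k. smul c (f k)) \<longlongrightarrow> smul c x) G"
proof -
  have "bounded_linear (smul c)"
  proof (rule bounded_linear_intro[where K = "norm c"])
    show "smul c (r *\<^sub>R x) = r *\<^sub>R smul c x" for r x
      by (simp add: scale_of_real[symmetric] scale_scale mult.commute)
  qed (simp_all add: scale_right_distrib norm_scale mult.commute)
  then show ?thesis using assms by (rule bounded_linear.tendsto)
qed

text \<open>The closure of the graph is again a linear subspace, and \<open>zero\<close>, applied to
  differences, makes it single-valued; it is therefore the graph of a closed extension.\<close>

lemma (in banach_space_over) closableI:
  assumes lin: "linear_operator smul D Z"
    and zero: "\<And>g. (0, g) \<in> closure ((\<lambda>x. (x, Z x)) ` D) \<Longrightarrow> g = 0"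
  shows "closable smul D Z"
proof -
  define G where "G = closure ((\<lambda>x. (x, Z x)) ` D)"
  have sub: "subspace D"
    and Zadd: "\<And>x y. x \<in> D \<Longrightarrow> y \<in> D \<Longrightarrow> Z (x + y) = Z x + Z y"
    and Zscale: "\<And>c x. x \<in> D \<Longrightarrow> Z (smul c x) = smul c (Z x)"
    using lin by (auto simp: linear_operator_def)
  have G_iff: "(x, y) \<in> G \<longleftrightarrow> (\<exists>u. (\<forall>k. u k \<in> D) \<and> u \<longlonglongrightarrow> x \<and> (\<lambda>k. Z (u k)) \<longlonglongrightarrow> y)" for x y
  proof
    assume "(x, y) \<in> G"
    then obtain p where p: "\<And>k. p k \<in> (\<lambda>x. (x, Z x)) ` D" and plim: "p \<longlonglongrightarrow> (x, y)"
      by (auto simp: G_def closure_sequential)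
    have "fst (p k) \<in> D \<and> snd (p k) = Z (fst (p k))" for k
      using p[of k] by auto
    then show "\<exists>u. (\<forall>k. u k \<in> D) \<and> u \<longlonglongrightarrow> x \<and> (\<lambda>k. Z (u k)) \<longlonglongrightarrow> y"
      using tendsto_fst[OF plim] tendsto_snd[OF plim]
      by (intro exI[of _ "\<lambda>k. fst (p k)"]) simp
  next
    assume "\<exists>u. (\<forall>k. u k \<in> D) \<and> u \<longlonglongrightarrow> x \<and> (\<lambda>k. Z (u k)) \<longlonglongrightarrow> y"
    then obtain u where "\<And>k. u k \<in> D" "u \<longlonglongrightarrow> x" "(\<lambda>k. Z (u k)) \<longlonglongrightarrow> y" by blast
    then show "(x, y) \<in> G"
      unfolding G_def closure_sequential
      by (intro exI[of _ "\<lambda>k. (u k, Z (u k))"]) (auto intro: tendsto_Pair)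
  qed
  have G_add: "(x + y, x' + y') \<in> G" if xy: "(x, x') \<in> G" "(y, y') \<in> G" for x x' y y'
  proof -
    obtain u v where "\<And>k. u k \<in> D" "u \<longlonglongrightarrow> x" "(\<lambda>k. Z (u k)) \<longlonglongrightarrow> x'"
      "\<And>k. v k \<in> D" "v \<longlonglongrightarrow> y" "(\<lambda>k. Z (v k)) \<longlonglongrightarrow> y'"
      using xy unfolding G_iff by blast
    then show ?thesis
      unfolding G_iff
      by (intro exI[of _ "\<lambda>k. u k + v k"]) (auto simp: Zadd intro: tendsto_add subspace_add[OF sub])
  qed
  have G_scale: "(smul c x, smul c x') \<in> G" if "(x, x') \<in> G" for c x x'
  proof -
    obtain u where "\<forall>k. u k \<in> D" "u \<longlonglongrightarrow> x" "(\<lambda>k. Z (u k)) \<longlonglongrightarrow> x'"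
      using \<open>(x, x') \<in> G\<close> unfolding G_iff by blast
    then show ?thesis
      unfolding G_iff
      by (intro exI[of _ "\<lambda>k. smul c (u k)"])
        (auto simp: Zscale intro: tendsto_smul subspace_scale[OF sub])
  qed
  have G_graph: "(x, Z x) \<in> G" if "x \<in> D" for x
    using that closure_subset[of "(\<lambda>x. (x, Z x)) ` D"] by (auto simp: G_def)
  have G_unique: "x' = x''" if "(x, x') \<in> G" "(x, x'') \<in> G" for x x' x''
  proof -
    have "(0, x' - x'') \<in> G"
      using G_add[OF that(1) G_scale[OF that(2), of "-1"]] by simp
    then have "x' - x'' = 0" unfolding G_def by (rule zero)
    then show ?thesis by simp
  qed
  define Z' where "Z' x = (THE y. (x, y) \<in> G)" for x
  have Z'_eq: "Z' x = y" if "(x, y) \<in> G" for x y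
    unfolding Z'_def using that G_unique by blast
  have graph: "(\<lambda>x. (x, Z' x)) ` Domain G = G"
    using Z'_eq by (fastforce simp: image_iff)
  \<comment> \<open>Scaling the graph point over 0 by 0 avoids computing \<open>Z 0\<close>.\<close>
  have G0: "(0, 0) \<in> G"
    using G_graph[OF subspace_0[OF sub]] G_scale[of 0 "Z 0" 0] by simp
  have "linear_operator smul (Domain G) Z'"
    unfolding linear_operator_def
  proof (intro conjI ballI allI)
    show "subspace (Domain G)"
      by (rule subspaceI) (use G0 G_add G_scale in blast)+
  next
    fix x y assume "x \<in> Domain G" "y \<in> Domain G"
    then show "Z' (x + y) = Z' x + Z' y"
      by (elim DomainE) (simp add: Z'_eq Z'_eq[OF G_add])
  next
    fix c x assume "x \<in> Domain G"
    then show "Z' (smul c x) = smul c (Z' x)"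
      by (elim DomainE) (simp add: Z'_eq Z'_eq[OF G_scale])
  qed
  then have "closed_operator smul (Domain G) Z'"
    unfolding closed_operator_def graph by (simp add: G_def)
  then show ?thesis
    unfolding closable_def using G_graph Z'_eq by blast
qed

theorem theorem3p1:
  fixes smul :: "'k::real_normed_field \<Rightarrow> 'x::banach \<Rightarrow> 'x"
    and F :: "real \<Rightarrow> 'x \<Rightarrow> 'x"
    and D :: "'x set"
    and Z :: "'x \<Rightarrow> 'x"
  assumes "banach_space_over smul"
    and "F \<in> class_F smul"
    and "linear_operator smul D Z"
    and "D \<subseteq> deriv0_domain F"
    and "\<forall>f\<in>D. Z f = deriv0 F f"
  shows "closable smul D Z"
proof -
  interpret banach_space_over smul by fact
  \<comment> \<open>The graph of the derivative at 0, given by convergence itself rather than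
    through \<open>Lim\<close>.\<close>
  define A where
    "A = {(x, y). ((\<lambda>h. (1 / h) *\<^sub>R (F h x - F 0 x)) \<longlongrightarrow> y) (at_right 0)}"
  have bl: "bounded_linear (F t)" if "t \<ge> 0" for t
    using assms(2) that by (auto simp: class_F_def bounded_operators_def)
  have F0: "F 0 = id" and dense: "closure (deriv0_domain F) = UNIV"
    using assms(2) by (auto simp: class_F_def)
  obtain M a :: real where M: "M \<ge> 1"
    and bnd: "\<And>(n::nat) (m::nat) s. n \<ge> 1 \<Longrightarrow> m \<ge> 1 \<Longrightarrow> s \<ge> 0 \<Longrightarrow>
      onorm (F (s / real n) ^^ m) \<le> M * exp (a * real m / real n * s)"
    using assms(2) unfolding class_F_def by blast
  have pow: "norm ((F h ^^ m) x) \<le> M * exp (a * h) ^ m * norm x" if h: "h \<ge> 0" for h m x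
  \<comment> \<open>The class bound is used with \<open>n = 1\<close> and \<open>s = h\<close>; it
    starts at \<open>m = 1\<close>, and \<open>m = 0\<close> follows from \<open>M\<close> being at
    least 1.\<close>
  proof (cases m)
    case 0
    then show ?thesis using M by (simp add: mult_le_cancel_right1)
  next
    case (Suc k)
    have "bounded_linear (F h ^^ j)" for j
      by (induction j)
        (auto intro: bounded_linear_compose[OF bl[OF h]] bounded_linear_ident simp: o_def id_def)
    then have "norm ((F h ^^ m) x) \<le> onorm (F h ^^ m) * norm x"
      by (rule onorm)
    also have "onorm (F h ^^ m) \<le> M * exp (a * h) ^ m"
      using bnd[of 1 m h] h Suc by (simp add: exp_of_nat_mult[symmetric] mult_ac del: power_Suc funpow.simps)
    finally show ?thesis by (simp add: mult_right_mono)
  qed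
  have diss: "(1 - l * a) * norm x \<le> M * norm (x - l *\<^sub>R y)" if l: "l \<ge> 0" and "(x, y) \<in> A" for l x y
  proof -
    have lim: "((\<lambda>h. (1 / h) *\<^sub>R (F h x - F 0 x)) \<longlongrightarrow> y) (at_right 0)"
      using that by (simp add: A_def)
    have ineq: "(1 - l * ((exp (a * h) - 1) / h)) * norm x
        \<le> M * norm (x - l *\<^sub>R ((1 / h) *\<^sub>R (F h x - F 0 x)))" if h: "h > 0" for h
    proof -
      \<comment> \<open>The choice \<open>s = l / h\<close> turns the combination of
        \<open>x\<close> and \<open>F h x\<close> into \<open>x\<close> minus \<open>l\<close> times
        the difference quotient; \<open>c\<close> is \<open>exp (a * h)\<close>.\<close>
      have "(1 + l / h - l / h * exp (a * h)) * norm x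
          \<le> M * norm ((1 + l / h) *\<^sub>R x - (l / h) *\<^sub>R F h x)"
        using h l by (intro power_bounded_dissipative pow bounded_linear.linear bl) auto
      also have "(1 + l / h) *\<^sub>R x - (l / h) *\<^sub>R F h x = x - l *\<^sub>R ((1 / h) *\<^sub>R (F h x - F 0 x))"
        by (simp add: F0 algebra_simps)
      also have "1 + l / h - l / h * exp (a * h) = 1 - l * ((exp (a * h) - 1) / h)"
        by (simp add: right_diff_distrib diff_divide_distrib)
      finally show ?thesis .
    qed
    have "((\<lambda>h. exp (a * h)) has_field_derivative a) (at 0)"
      by (auto intro!: derivative_eq_intros)
    then have "((\<lambda>h. (exp (a * h) - 1) / h) \<longlongrightarrow> a) (at_right 0)"
      by (auto simp: DERIV_def intro: tendsto_within_subset)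
    then have "((\<lambda>h. (1 - l * ((exp (a * h) - 1) / h)) * norm x) \<longlongrightarrow> (1 - l * a) * norm x)
        (at_right 0)"
      by (intro tendsto_intros)
    moreover have "((\<lambda>h. M * norm (x - l *\<^sub>R ((1 / h) *\<^sub>R (F h x - F 0 x))))
        \<longlongrightarrow> M * norm (x - l *\<^sub>R y)) (at_right 0)"
      by (intro tendsto_intros lim)
    ultimately show ?thesis
      using ineq by (intro tendsto_le[OF trivial_limit_at_right_real])
        (auto simp: eventually_at_filter)
  qed
  have A_add: "(x + y, x' + y') \<in> A" if "(x, x') \<in> A" "(y, y') \<in> A" for x x' y y'
  proof -
    have "((\<lambda>h. (1 / h) *\<^sub>R (F h x - F 0 x) + (1 / h) *\<^sub>R (F h y - F 0 y)) \<longlongrightarrow> x' + y') (at_right 0)"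
      using that by (auto simp: A_def intro: tendsto_add)
    \<comment> \<open>Linearity of \<open>F h\<close> is known for nonnegative \<open>h\<close>,
      hence eventually at the right of 0.\<close>
    moreover have "\<forall>\<^sub>F h in at_right 0.
        (1 / h) *\<^sub>R (F h x - F 0 x) + (1 / h) *\<^sub>R (F h y - F 0 y)
        = (1 / h) *\<^sub>R (F h (x + y) - F 0 (x + y))"
      by (auto simp: eventually_at_filter F0 algebra_simps bounded_linear.linear[OF bl, THEN linear_add])
    ultimately show ?thesis
      unfolding A_def by (auto elim: Lim_transform_eventually)
  qed
  have A_scale: "(r *\<^sub>R x, r *\<^sub>R x') \<in> A" if "(x, x') \<in> A" for r x x'
  proof -
    have "((\<lambda>h. r *\<^sub>R ((1 / h) *\<^sub>R (F h x - F 0 x))) \<longlongrightarrow> r *\<^sub>R x') (at_right 0)"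
      by (rule tendsto_scaleR[OF tendsto_const]) (use that in \<open>simp add: A_def\<close>)
    moreover have "\<forall>\<^sub>F h in at_right 0.
        r *\<^sub>R ((1 / h) *\<^sub>R (F h x - F 0 x)) = (1 / h) *\<^sub>R (F h (r *\<^sub>R x) - F 0 (r *\<^sub>R x))"
      by (auto simp: eventually_at_filter F0 algebra_simps bounded_linear.linear[OF bl, THEN linear_scale])
    ultimately show ?thesis
      unfolding A_def by (auto elim: Lim_transform_eventually)
  qed
  have Dom: "Domain A = deriv0_domain F"
    by (auto simp: A_def deriv0_domain_def)
  have graph: "(\<lambda>x. (x, Z x)) ` D \<subseteq> A"
  proof clarify
    fix x assume "x \<in> D"
    then obtain y where "((\<lambda>h. (1 / h) *\<^sub>R (F h x - F 0 x)) \<longlongrightarrow> y) (at_right 0)"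
      using assms(4) by (auto simp: deriv0_domain_def)
    moreover from this have "deriv0 F x = y"
      unfolding deriv0_def by (intro tendsto_Lim trivial_limit_at_right_real)
    ultimately show "(x, Z x) \<in> A"
      using assms(5) \<open>x \<in> D\<close> by (simp add: A_def)
  qed
  show ?thesis
  proof (rule closableI[OF assms(3)])
    fix g assume "(0, g) \<in> closure ((\<lambda>x. (x, Z x)) ` D)"
    then have g: "(0, g) \<in> closure A"
      \<comment> \<open>The test vectors must range over a dense set. The domain of \<open>A\<close>
        is dense while \<open>D\<close> may not be, so the argument is run for \<open>A\<close> and
        not for \<open>Z\<close>.\<close>
      using closure_mono[OF graph] by blast
    show "g = 0"
      by (rule quasi_dissipative_closable[of A a M])
        (use A_add A_scale diss dense g in \<open>simp_all add: Dom\<close>)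
  qed
qed

end
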